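(* Consider an instance of the semi-infinite convex program (SICP) satisfying Assumptions 1 and 2 (both stated in the context), and an execution of the central cutting surface algorithm described in the context on this instance. Suppose that the algorithm does not terminate. Then the sequence $(y^{(k)})_{k=1,2,\dots}$ has an accumulation point, and each accumulation point of it is an $\varepsilon$-optimal solution to (SICP).
   Context: **Problem (SICP).** Minimize $x_0$ subject to $g(x,t)\le 0$ for all $t\in T$ and $x\in X$, where $X\subseteq\mathbb{R}^n$, $x_0$ denotes the first coordinate of $x\in\mathbb{R}^n$, $T$ is an index set (not required to be convex or finite dimensional), and $g\colon X\times T\to\mathbb{R}$. **Assumption 1.** (1) The set $X$ is convex, closed and bounded. (2) There exist a Slater point $\bar x$ and $\eta>0$ satisfying $\bar x\in X$ and $g(\bar x,t)\le-\eta$ for every $t\in T$. (3) The function $g(\cdot,t)$ is convex and subdifferentiable for every $t\in T$; moreover, these subdifferentials are uniformly bounded: there exists $B>0$ such that for every $x\in X$ and $t\in T$, every subgradient $d\in\partial_x g(x,t)$ (the subdifferential of $g(\cdot,t)$ at $x$) satisfies $\|d\|\le B$. **Optimality notions.** Let $\varepsilon\ge0$. A point $x\in X$ is $\varepsilon$-feasible if $g(x,t)\le\varepsilon$ for every $t\in T$. Let $x^*$ be an optimal solution of (SICP) (the minimum is attained), so $x_0^*$ is the optimal value. A point of $X$ is an $\varepsilon$-optimal solution to (SICP) if it is $\varepsilon$-feasible and its first coordinate is at most $x_0^*$. **Assumption 2 (with tolerance $\varepsilon$).** For every point $x\in X$ that is not $\varepsilon$-feasible, we can find in finite time a $t\in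 T$ satisfying $g(x,t)>0$. (For $\varepsilon$-feasible $x$ the search may either find some $t\in T$ with $g(x,t)>0$ or find none.) **Central cutting surface algorithm.** Parameters: a strict upper bound $U$ on the optimal value of (SICP); $B>0$ for which Assumption 1 holds; $\varepsilon\ge0$ for which Assumption 2 holds; an arbitrary $\beta>1$ ($\beta=\infty$, meaning no cuts are dropped, is allowed). - Step 1. Set $k=1$, $y^{(0)}=(U,0,\dots,0)\in\mathbb{R}^n$, $J^{(0)}=\emptyset$. - Step 2. Determine the optimal solution $(x^{(k)},\sigma^{(k)})$ of the master problem: maximize $\sigma$ over $(x,\sigma)$ subject to $x_0+\sigma\le y_0^{(k-1)}$; $g(x,t^{(j)})+\sigma s^{(j)}\le0$ for all $j\in J^{(k-1)}$; $x\in X$. - Step 3. If $\sigma^{(k)}=0$, stop and return $y^{(k-1)}$. - Step 4. Find a $t^{(k)}\in T$ satisfying $g(x^{(k)},t^{(k)})>0$ if possible (in the sense of Assumption 2). If no such $t^{(k)}$ is found, go to Step 6. - Step 5 (feasibility cut). Set $J^{(k)}=J^{(k-1)}\cup\{k\}$, $y^{(k)}=y^{(k-1)}$, and choose a centering parameter $s^{(k)}$. Go to Step 7. - Step 6 (optimality cut). Set $J^{(k)}=J^{(k-1)}$, $y^{(k)}=x^{(k)}$. - Step 7 (drop cuts). Let $D=\{j\in J^{(k)} : \sigma^{(j)}\ge\beta\sigma^{(k)}\text{ and } g(x^{(k)},t^{(j)})+\sigma^{(k)}s^{(j)}<0\}$ and replace $J^{(k)}$ by $J^{(k)}\setminus D$.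 - Step 8. Increase $k$ by one and go to Step 2. **Centering parameters.** They are chosen by one of two strategies: (i) $s_{\min}\le s^{(k)}\le B$ for every $k$, with some $s_{\min}>0$; or (ii) $s^{(k)}=\alpha\|d\|$ with a subgradient $d\in\partial_x g(x^{(k)},t^{(k)})$ and an arbitrary $\alpha\in(0,1]$. *)

theory Defs
  imports "HOL-Analysis.Analysis"
begin

definition subdiff_on :: "'a::real_inner set \<Rightarrow> ('a \<Rightarrow> real) \<Rightarrow> 'a \<Rightarrow> 'a set" where
  "subdiff_on \<Omega> f x = {d. \<forall>z\<in>\<Omega>. f z \<ge> f x + d \<bullet> (z - x)}"

(* Problem data: X is the feasible domain, T the index set, g the constraint function and i0 the
   distinguished ("first") coordinate, whose value is minimised. *)

definition sicp_feasible ::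
  "'a set \<Rightarrow> 't set \<Rightarrow> ('a \<Rightarrow> 't \<Rightarrow> real) \<Rightarrow> 'a \<Rightarrow> bool" where
  "sicp_feasible X T g x \<longleftrightarrow> x \<in> X \<and> (\<forall>t\<in>T. g x t \<le> 0)"

definition sicp_optimal ::
  "'n::finite \<Rightarrow> (real^'n) set \<Rightarrow> 't set \<Rightarrow> (real^'n \<Rightarrow> 't \<Rightarrow> real) \<Rightarrow> real^'n \<Rightarrow> bool" where
  "sicp_optimal i0 X T g x \<longleftrightarrow> is_arg_min (\<lambda>z. z $ i0) (sicp_feasible X T g) x"

definition eps_feasible ::
  "'a set \<Rightarrow> 't set \<Rightarrow> ('a \<Rightarrow> 't \<Rightarrow> real) \<Rightarrow> real \<Rightarrow> 'a \<Rightarrow> bool" where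
  "eps_feasible X T g \<epsilon> x \<longleftrightarrow> x \<in> X \<and> (\<forall>t\<in>T. g x t \<le> \<epsilon>)"

definition eps_optimal ::
  "'n::finite \<Rightarrow> (real^'n) set \<Rightarrow> 't set \<Rightarrow> (real^'n \<Rightarrow> 't \<Rightarrow> real) \<Rightarrow> real \<Rightarrow> real^'n \<Rightarrow> real^'n \<Rightarrow> bool" where
  "eps_optimal i0 X T g \<epsilon> xstar x \<longleftrightarrow> eps_feasible X T g \<epsilon> x \<and> x $ i0 \<le> xstar $ i0"

(* \<Omega> is a set containing X on which the functions g(.,t) are convex and with respect to which
   their subgradients are taken (for instance the whole space or a neighbourhood of X). Taking
   \<Omega> = X is permitted, but then the uniform bound is unsatisfiable for a nonempty compact X:
   at a boundary point the subdifferential relative to X absorbs the normal cone of X and is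
   empty or unbounded. *)
definition sicp_assumption1 ::
  "(real^'n::finite) set \<Rightarrow> (real^'n) set \<Rightarrow> 't set \<Rightarrow> (real^'n \<Rightarrow> 't \<Rightarrow> real) \<Rightarrow> real \<Rightarrow> bool" where
  "sicp_assumption1 \<Omega> X T g B \<longleftrightarrow>
     convex X \<and> closed X \<and> bounded X \<and>
     (\<exists>xbar\<in>X. \<exists>\<eta>>0. \<forall>t\<in>T. g xbar t \<le> - \<eta>) \<and>
     X \<subseteq> \<Omega> \<and>
     (\<forall>t\<in>T. convex_on \<Omega> (\<lambda>z. g z t)) \<and>
     (\<forall>x\<in>X. \<forall>t\<in>T. subdiff_on \<Omega> (\<lambda>z. g z t) x \<noteq> {}) \<and>
     B > 0 \<and>
     (\<forall>x\<in>X. \<forall>t\<in>T. \<forall>d\<in>subdiff_on \<Omega> (\<lambda>z. g z t) x. norm d \<le> B)"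

(* search x is the set of possible outcomes of the (terminating, possibly nondeterministic) search
   for a violated constraint at x: Some t if t was found, None if the search gave up. At points
   that are not eps-feasible, the search must have an outcome and every outcome is a success. *)
definition sicp_assumption2 ::
  "'a set \<Rightarrow> 't set \<Rightarrow> ('a \<Rightarrow> 't \<Rightarrow> real) \<Rightarrow> real \<Rightarrow> ('a \<Rightarrow> 't option set) \<Rightarrow> bool" where
  "sicp_assumption2 X T g \<epsilon> search \<longleftrightarrow>
     (\<forall>x\<in>X. \<forall>t. Some t \<in> search x \<longrightarrow> t \<in> T \<and> g x t > 0) \<and>
     (\<forall>x\<in>X. \<not> eps_feasible X T g \<epsilon> x \<longrightarrow> (\<exists>t. Some t \<in> search x) \<and> None \<notin> search x)"

datatype centering_strategy =
    Bounded_Centering real      (* s_min *)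
  | Subgradient_Centering real  (* alpha *)

fun valid_strategy :: "centering_strategy \<Rightarrow> bool" where
  "valid_strategy (Bounded_Centering smin) \<longleftrightarrow> smin > 0"
| "valid_strategy (Subgradient_Centering \<alpha>) \<longleftrightarrow> 0 < \<alpha> \<and> \<alpha> \<le> 1"

fun centering_choice ::
  "centering_strategy \<Rightarrow> (real^'n::finite) set \<Rightarrow> (real^'n \<Rightarrow> 't \<Rightarrow> real) \<Rightarrow> real
     \<Rightarrow> real^'n \<Rightarrow> 't \<Rightarrow> real \<Rightarrow> bool" where
  "centering_choice (Bounded_Centering smin) \<Omega> g B x t s \<longleftrightarrow> smin \<le> s \<and> s \<le> B"
| "centering_choice (Subgradient_Centering \<alpha>) \<Omega> g B x t s \<longleftrightarrow>
     (\<exists>d\<in>subdiff_on \<Omega> (\<lambda>z. g z t) x. s = \<alpha> * norm d)"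

definition master_feasible ::
  "'n::finite \<Rightarrow> (real^'n) set \<Rightarrow> (real^'n \<Rightarrow> 't \<Rightarrow> real) \<Rightarrow> (nat \<Rightarrow> 't) \<Rightarrow> (nat \<Rightarrow> real)
     \<Rightarrow> real^'n \<Rightarrow> nat set \<Rightarrow> (real^'n) \<times> real \<Rightarrow> bool" where
  "master_feasible i0 X g t s y J = (\<lambda>(x, \<sigma>).
     x $ i0 + \<sigma> \<le> y $ i0 \<and> (\<forall>j\<in>J. g x (t j) + \<sigma> * s j \<le> 0) \<and> x \<in> X)"

definition master_optimal ::
  "'n::finite \<Rightarrow> (real^'n) set \<Rightarrow> (real^'n \<Rightarrow> 't \<Rightarrow> real) \<Rightarrow> (nat \<Rightarrow> 't) \<Rightarrow> (nat \<Rightarrow> real)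
     \<Rightarrow> real^'n \<Rightarrow> nat set \<Rightarrow> (real^'n) \<times> real \<Rightarrow> bool" where
  "master_optimal i0 X g t s y J = is_arg_max snd (master_feasible i0 X g t s y J)"

(* The case \<beta> = \<infinity> (no cut is ever dropped) is kept separate because \<infinity> * \<sigma> k would be -\<infinity> in
   the extended reals for \<sigma> k < 0, which is not excluded by the algorithm when \<epsilon> > 0. *)
definition dropped_cuts ::
  "ereal \<Rightarrow> (real^'n::finite \<Rightarrow> 't \<Rightarrow> real) \<Rightarrow> (nat \<Rightarrow> real^'n) \<Rightarrow> (nat \<Rightarrow> real) \<Rightarrow> (nat \<Rightarrow> 't)
     \<Rightarrow> (nat \<Rightarrow> real) \<Rightarrow> nat \<Rightarrow> nat set \<Rightarrow> nat set" where
  "dropped_cuts \<beta> g x \<sigma> t s k J =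
     {j \<in> J. \<beta> \<noteq> \<infinity> \<and> \<sigma> j \<ge> real_of_ereal \<beta> * \<sigma> k \<and> g (x k) (t j) + \<sigma> k * s j < 0}"

(* First disjunct: feasibility cut; second: optimality cut, where t k and s k are irrelevant. *)
definition cut_update ::
  "(real^'n::finite) set \<Rightarrow> (real^'n \<Rightarrow> 't \<Rightarrow> real) \<Rightarrow> real \<Rightarrow> ereal \<Rightarrow> (real^'n \<Rightarrow> 't option set)
     \<Rightarrow> centering_strategy \<Rightarrow> (nat \<Rightarrow> real^'n) \<Rightarrow> (nat \<Rightarrow> real) \<Rightarrow> (nat \<Rightarrow> 't) \<Rightarrow> (nat \<Rightarrow> real)
     \<Rightarrow> (nat \<Rightarrow> real^'n) \<Rightarrow> (nat \<Rightarrow> nat set) \<Rightarrow> nat \<Rightarrow> bool" where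
  "cut_update \<Omega> g B \<beta> search strat x \<sigma> t s y J k \<longleftrightarrow>
     (Some (t k) \<in> search (x k) \<and>
      centering_choice strat \<Omega> g B (x k) (t k) (s k) \<and>
      y k = y (k - 1) \<and>
      (let J' = insert k (J (k - 1)) in J k = J' - dropped_cuts \<beta> g x \<sigma> t s k J'))
   \<or> (None \<in> search (x k) \<and>
      y k = x k \<and>
      (let J' = J (k - 1) in J k = J' - dropped_cuts \<beta> g x \<sigma> t s k J'))"

(* Iteration k is performed as long as no earlier iteration stopped with \<sigma> j = 0; beyond the
   stopping iteration the sequences are unconstrained. *)
definition cutting_surface_execution ::
  "'n::finite \<Rightarrow> (real^'n) set \<Rightarrow> (real^'n) set \<Rightarrow> (real^'n \<Rightarrow> 't \<Rightarrow> real) \<Rightarrow> real \<Rightarrow> real \<Rightarrow> ereal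
     \<Rightarrow> (real^'n \<Rightarrow> 't option set) \<Rightarrow> centering_strategy \<Rightarrow> (nat \<Rightarrow> real^'n) \<Rightarrow> (nat \<Rightarrow> real)
     \<Rightarrow> (nat \<Rightarrow> 't) \<Rightarrow> (nat \<Rightarrow> real) \<Rightarrow> (nat \<Rightarrow> real^'n) \<Rightarrow> (nat \<Rightarrow> nat set) \<Rightarrow> bool" where
  "cutting_surface_execution i0 \<Omega> X g U B \<beta> search strat x \<sigma> t s y J \<longleftrightarrow>
     y 0 = axis i0 U \<and> J 0 = {} \<and>
     (\<forall>k\<ge>1. (\<forall>j\<in>{1..<k}. \<sigma> j \<noteq> 0) \<longrightarrow>
        master_optimal i0 X g t s (y (k - 1)) (J (k - 1)) (x k, \<sigma> k) \<and>
        (\<sigma> k \<noteq> 0 \<longrightarrow> cut_update \<Omega> g B \<beta> search strat x \<sigma> t s y J k))"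

definition execution_terminates :: "(nat \<Rightarrow> real) \<Rightarrow> bool" where
  "execution_terminates \<sigma> \<longleftrightarrow> (\<exists>k\<ge>1. \<sigma> k = 0)"

definition accumulation_point :: "(nat \<Rightarrow> 'a::topological_space) \<Rightarrow> 'a \<Rightarrow> bool" where
  "accumulation_point u z \<longleftrightarrow> (\<exists>r. strict_mono r \<and> (u \<circ> r) \<longlonglongrightarrow> z)"

end

theory Submission
  imports Defs
begin

text \<open>
Two mechanisms drive the convergence. The first is that \<open>\<sigma>\<close> measures how far the current value
\<open>y\<^sub>0\<close> lies above the optimal value \<open>x\<^sup>*\<^sub>0\<close>: moving \<open>x\<^sup>*\<close> a little towards the Slater point gives a
point that satisfies all cuts with a margin, so \<open>y\<^sub>0 \<ge> x\<^sup>*\<^sub>0 + \<delta>\<close> forces \<open>\<sigma> \<ge> c\<close> for some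
\<open>c > 0\<close> that depends only on \<open>\<delta>\<close> (\<open>sigma_bounded_below\<close>). The second is that \<open>\<sigma>\<close> cannot stay above a
positive \<open>c\<close> forever (\<open>sigma_not_bounded_away\<close>). Each optimality cut would lower \<open>y\<^sub>0\<close> by at
least \<open>c\<close>, so only finitely many occur. Every later iteration adds a feasibility cut, and, as long as
that cut is retained, it keeps all later iterates at distance at least \<open>c s\<^bsub>min\<^esub> / B\<close> from the
point where it was generated, because \<open>g\<close> is \<open>B\<close>-Lipschitz. Infinitely many such separated points do
not fit into the bounded set \<open>X\<close>.

Cut dropping does not spoil this argument: dropped cuts are inactive, so by convexity their removal does
not change the optimum of the master problem, and \<open>\<sigma>\<close> is nonincreasing while it is positive
(\<open>sigma_nonincreasing\<close>). It thus converges to a limit at least \<open>c\<close>, the ratios of late terms tend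
to 1, and since \<open>\<beta> > 1\<close> no late cut ever satisfies the dropping criterion.

Both strategies for the centering parameters reduce to bounds \<open>0 < s\<^bsub>min\<^esub> \<le> s \<le> B\<close>
(\<open>centering_bounds\<close>). For \<open>\<epsilon> > 0\<close> the value \<open>y\<^sub>0\<close> may fall below \<open>x\<^sup>*\<^sub>0\<close> and \<open>\<sigma>\<close> may become
negative, but \<open>y\<^sub>0\<close> never rises above \<open>x\<^sup>*\<^sub>0\<close> again (\<open>objective_below_optimum_stays\<close>). Hence for every
\<open>\<delta> > 0\<close> eventually \<open>y\<^sub>0 \<le> x\<^sup>*\<^sub>0 + \<delta>\<close>. In particular \<open>y\<^sub>0 < U\<close> eventually, so \<open>y\<close> has then been set by an
optimality cut and is \<open>\<epsilon>\<close>-feasible. Compactness of \<open>X\<close> and closedness of the \<open>\<epsilon>\<close>-feasible set give the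
claim.
\<close>

section \<open>Sequences and perturbation of strict inequalities\<close>

lemma eventually_ratio_less_of_decseq:
  fixes f :: "nat \<Rightarrow> real"
  assumes "decseq f" and "c > 0" and "\<And>k. c \<le> f k" and "b > 1"
  shows "\<exists>K. \<forall>j\<ge>K. \<forall>k\<ge>K. f j < b * f k"
proof -
  obtain l where l: "f \<longlonglongrightarrow> l" "\<And>k. l \<le> f k"
    using decseq_convergent[OF \<open>decseq f\<close>] assms(3) by metis
  have "c \<le> l"
    using LIMSEQ_le_const[OF l(1)] assms(3) by blast
  with assms have "l < b * l" by simp
  with l(1) obtain K where K: "\<And>j. j \<ge> K \<Longrightarrow> f j < b * l"
    unfolding order_tendsto_iff eventually_sequentially by blast
  have "f j < b * f k" if "j \<ge> K" for j k
    using K[OF that] l(2)[of k] \<open>b > 1\<close>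
    by (meson less_le_trans mult_left_mono less_eq_real_def less_trans zero_less_one)
  then show ?thesis by blast
qed

lemma bounded_sequence_not_separated:
  fixes u :: "nat \<Rightarrow> 'a::heine_borel"
  assumes "bounded (range u)" and "e > 0"
  shows "\<exists>j k. j < k \<and> dist (u k) (u j) < e"
proof -
  obtain l r where r: "strict_mono r" "(u \<circ> r) \<longlonglongrightarrow> l"
    using bounded_imp_convergent_subsequence[OF assms(1)] by blast
  have "Cauchy (u \<circ> r)"
    using r(2) LIMSEQ_imp_Cauchy by blast
  then obtain N where "\<And>m n. m \<ge> N \<Longrightarrow> n \<ge> N \<Longrightarrow> dist ((u \<circ> r) m) ((u \<circ> r) n) < e"
    using assms(2) unfolding Cauchy_def by meson
  from this[of "Suc N" N] have "dist (u (r (Suc N))) (u (r N)) < e"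
    by simp
  moreover have "r N < r (Suc N)"
    using r(1) by (simp add: strict_mono_Suc_iff)
  ultimately show ?thesis by blast
qed

text \<open>
A sufficiently short step from the values \<open>a\<close> towards arbitrary values \<open>b\<close> preserves finitely many
strict inequalities. This is what makes inactive constraints irrelevant for a convex optimum.
\<close>

lemma inactive_cut_slack:
  fixes a b :: "'i \<Rightarrow> real"
  assumes "finite D" and "\<And>j. j \<in> D \<Longrightarrow> a j < 0"
  shows "\<exists>\<mu>. 0 < \<mu> \<and> \<mu> \<le> 1 \<and> (\<forall>j\<in>D. (1 - \<mu>) * a j + \<mu> * b j \<le> 0)"
proof -
  have "eventually (\<lambda>\<mu>. (1 - \<mu>) * a j + \<mu> * b j < 0) (at_right 0)" if "j \<in> D" for j
  proof -
    have "((\<lambda>\<mu>. (1 - \<mu>) * a j + \<mu> * b j) \<longlongrightarrow> (1 - 0) * a j + 0 * b j) (at_right (0::real))"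
      by (intro tendsto_intros)
    with assms(2)[OF that] show ?thesis
      by (auto dest: order_tendstoD(2)[where a = 0])
  qed
  then have "eventually (\<lambda>\<mu>. \<forall>j\<in>D. (1 - \<mu>) * a j + \<mu> * b j < 0) (at_right (0::real))"
    using assms(1) by (simp add: eventually_ball_finite)
  moreover have "eventually (\<lambda>\<mu>::real. 0 < \<mu> \<and> \<mu> < 1) (at_right 0)"
    using eventually_at_right_real[of 0 "1::real"] by simp
  ultimately have "eventually (\<lambda>\<mu>. (0 < \<mu> \<and> \<mu> < 1) \<and>
      (\<forall>j\<in>D. (1 - \<mu>) * a j + \<mu> * b j < 0)) (at_right (0::real))"
    by (rule eventually_conj[rotated])
  then obtain \<mu> where "0 < \<mu>" "\<mu> < 1" "\<forall>j\<in>D. (1 - \<mu>) * a j + \<mu> * b j < 0"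
    using eventually_happens'[OF trivial_limit_at_right_real] by blast
  then show ?thesis by (intro exI[of _ \<mu>]) auto
qed

section \<open>Instance and execution\<close>

locale nonterminating_execution =
  fixes i0 :: "'n::finite"
    and X \<Omega> :: "(real^'n) set"
    and T :: "'t set"
    and g :: "real^'n \<Rightarrow> 't \<Rightarrow> real"
    and U B \<epsilon> :: real
    and \<beta> :: ereal
    and search :: "real^'n \<Rightarrow> 't option set"
    and strat :: centering_strategy
    and xstar :: "real^'n"
    and x y :: "nat \<Rightarrow> real^'n"
    and \<sigma> s :: "nat \<Rightarrow> real"
    and t :: "nat \<Rightarrow> 't"
    and J :: "nat \<Rightarrow> nat set"
  assumes regular: "sicp_assumption1 \<Omega> X T g B"
    and search: "sicp_assumption2 X T g \<epsilon> search"
    and optimal: "sicp_optimal i0 X T g xstar"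
    and U_gt: "xstar $ i0 < U"
    and \<beta>_gt: "\<beta> > 1"
    and strategy: "valid_strategy strat"
    and execution: "cutting_surface_execution i0 \<Omega> X g U B \<beta> search strat x \<sigma> t s y J"
    and nonterminating: "\<not> execution_terminates \<sigma>"
begin

lemma X_convex: "convex X" and X_bounded: "bounded X" and X_closed: "closed X"
  and X_subset: "X \<subseteq> \<Omega>" and B_pos: "B > 0"
  using regular unfolding sicp_assumption1_def by metis+

lemma g_convex: "convex_on X (\<lambda>z. g z t')" if "t' \<in> T"
proof -
  have "convex_on \<Omega> (\<lambda>z. g z t')"
    using regular that unfolding sicp_assumption1_def by metis
  then show ?thesis
    using convex_on_subset X_subset X_convex by blast
qed

lemma subgradient_exists:
  assumes "z \<in> X" "t' \<in> T"
  obtains d where "d \<in> subdiff_on \<Omega> (\<lambda>w. g w t') z"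
proof -
  have "subdiff_on \<Omega> (\<lambda>w. g w t') z \<noteq> {}"
    using regular assms unfolding sicp_assumption1_def by metis
  with that show thesis by blast
qed

lemma subgradient_bounded:
  assumes "z \<in> X" "t' \<in> T" "d \<in> subdiff_on \<Omega> (\<lambda>w. g w t') z"
  shows "norm d \<le> B"
  using regular assms unfolding sicp_assumption1_def by metis

lemma subgradient_inequality:
  assumes "d \<in> subdiff_on \<Omega> (\<lambda>w. g w t') z" "z' \<in> X"
  shows "g z t' + d \<bullet> (z' - z) \<le> g z' t'"
  using assms X_subset by (auto simp: subdiff_on_def)

lemma g_lipschitz:
  assumes "t' \<in> T"
  shows "B-lipschitz_on X (\<lambda>z. g z t')"
proof -
  have lower: "g z t' - g z' t' \<le> B * norm (z - z')" if zs: "z \<in> X" "z' \<in> X" for z z'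
  proof -
    obtain d where d: "d \<in> subdiff_on \<Omega> (\<lambda>w. g w t') z"
      using subgradient_exists zs(1) assms by blast
    have "norm d \<le> B"
      using subgradient_bounded[OF zs(1) assms d] .
    then have "- (d \<bullet> (z' - z)) \<le> B * norm (z' - z)"
      using Cauchy_Schwarz_ineq2[of d "z' - z"] mult_right_mono[of "norm d" B "norm (z' - z)"]
      by simp
    with subgradient_inequality[OF d zs(2)] show ?thesis by (simp add: norm_minus_commute)
  qed
  show ?thesis
  proof (rule lipschitz_onI)
    show "dist (g z t') (g z' t') \<le> B * dist z z'" if "z \<in> X" "z' \<in> X" for z z'
      using lower[OF that] lower[OF that(2,1)]
      by (simp add: dist_norm norm_minus_commute abs_le_iff)
  qed (use B_pos in simp)
qed

lemma closed_eps_feasible: "closed {z. eps_feasible X T g \<epsilon> z}"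
proof -
  have "{z. eps_feasible X T g \<epsilon> z} = X \<inter> (\<Inter>t'\<in>T. {z \<in> X. g z t' \<le> \<epsilon>})"
    by (auto simp: eps_feasible_def)
  moreover have "closed {z \<in> X. g z t' \<le> \<epsilon>}" if "t' \<in> T" for t'
    using continuous_on_closed_Collect_le[OF
        lipschitz_on_continuous_on[OF g_lipschitz[OF that]] continuous_on_const]
      X_closed by simp
  ultimately show ?thesis
    using X_closed by (simp add: closed_Int closed_INT)
qed

lemma slater_point:
  obtains xbar \<eta> where "xbar \<in> X" "\<eta> > 0" "\<And>t'. t' \<in> T \<Longrightarrow> g xbar t' \<le> - \<eta>"
  using regular that unfolding sicp_assumption1_def by blast

lemma xstar_feasible: "xstar \<in> X" "t' \<in> T \<Longrightarrow> g xstar t' \<le> 0"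
  using optimal by (auto simp: sicp_optimal_def is_arg_min_def sicp_feasible_def)

text \<open>
The guard on earlier iterations in the description of an execution always holds here. Iterations are
indexed by \<open>Suc k\<close> so that the preceding state is \<open>y k\<close> and \<open>J k\<close>.
\<close>

lemma iteration:
  "master_optimal i0 X g t s (y k) (J k) (x (Suc k), \<sigma> (Suc k))"
  "cut_update \<Omega> g B \<beta> search strat x \<sigma> t s y J (Suc k)"
proof -
  have nz: "\<sigma> j \<noteq> 0" if "j \<ge> 1" for j
    using nonterminating that by (auto simp: execution_terminates_def)
  have "\<forall>j\<in>{1..<Suc k}. \<sigma> j \<noteq> 0" using nz by auto
  then have "master_optimal i0 X g t s (y (Suc k - 1)) (J (Suc k - 1)) (x (Suc k), \<sigma> (Suc k)) \<and>
    (\<sigma> (Suc k) \<noteq> 0 \<longrightarrow> cut_update \<Omega> g B \<beta> search strat x \<sigma> t s y J (Suc k))"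
    using execution unfolding cutting_surface_execution_def by (metis Suc_eq_plus1 le_add2)
  then show "master_optimal i0 X g t s (y k) (J k) (x (Suc k), \<sigma> (Suc k))"
    "cut_update \<Omega> g B \<beta> search strat x \<sigma> t s y J (Suc k)"
    using nz by auto
qed

lemma initial: "y 0 $ i0 = U" "J 0 = {}"
  using execution by (auto simp: cutting_surface_execution_def axis_def)

lemma master_solution:
  "x (Suc k) \<in> X"
  "x (Suc k) $ i0 + \<sigma> (Suc k) \<le> y k $ i0"
  "j \<in> J k \<Longrightarrow> g (x (Suc k)) (t j) + \<sigma> (Suc k) * s j \<le> 0"
  using iteration(1)[of k] by (auto simp: master_optimal_def is_arg_max_def master_feasible_def)

lemma master_maximal:
  assumes "z \<in> X" "z $ i0 + \<tau> \<le> y k $ i0" "\<And>j. j \<in> J k \<Longrightarrow> g z (t j) + \<tau> * s j \<le> 0"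
  shows "\<tau> \<le> \<sigma> (Suc k)"
proof -
  have "master_feasible i0 X g t s (y k) (J k) (z, \<tau>)"
    using assms by (simp add: master_feasible_def)
  then have "\<not> snd (z, \<tau>) > snd (x (Suc k), \<sigma> (Suc k))"
    using iteration(1)[of k] unfolding master_optimal_def is_arg_max_def by blast
  then show ?thesis by simp
qed

definition feasibility_cut :: "nat \<Rightarrow> bool" where
  "feasibility_cut k \<longleftrightarrow> x k \<in> X \<and> t k \<in> T \<and> g (x k) (t k) > 0 \<and>
     centering_choice strat \<Omega> g B (x k) (t k) (s k)"

text \<open>
The search outcome at \<open>x (Suc k)\<close> enters the convergence argument only through what it certifies: a
violated constraint, or \<open>\<epsilon>\<close>-feasibility.
\<close>

lemma iteration_cases:
  obtains (feasibility) "feasibility_cut (Suc k)" "y (Suc k) = y k"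
      "J (Suc k) = insert (Suc k) (J k) - dropped_cuts \<beta> g x \<sigma> t s (Suc k) (insert (Suc k) (J k))"
  | (optimality) "eps_feasible X T g \<epsilon> (x (Suc k))" "y (Suc k) = x (Suc k)"
      "J (Suc k) = J k - dropped_cuts \<beta> g x \<sigma> t s (Suc k) (J k)"
proof -
  have "Some (t (Suc k)) \<in> search (x (Suc k)) \<Longrightarrow> t (Suc k) \<in> T \<and> g (x (Suc k)) (t (Suc k)) > 0"
    "None \<in> search (x (Suc k)) \<Longrightarrow> eps_feasible X T g \<epsilon> (x (Suc k))"
    using search master_solution(1)[of k] unfolding sicp_assumption2_def by blast+
  then show thesis
    using iteration(2)[of k] that master_solution(1)[of k]
    unfolding cut_update_def feasibility_cut_def Let_def by auto
qed

lemma J_feasibility_cut: "finite (J k) \<and> (\<forall>j\<in>J k. feasibility_cut j)"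
proof (induction k)
  case (Suc k)
  then show ?case by (cases k rule: iteration_cases) auto
qed (simp add: initial)

text \<open>
For subgradient centering the lower bound comes from the Slater point: a subgradient at a point that
violates the constraint must account for a decrease by at least \<open>\<eta>\<close> over the way to the Slater point,
which is no longer than the diameter of \<open>X\<close>, so the subgradient cannot be short.
\<close>

lemma centering_bounds:
  obtains smin where "smin > 0" "\<And>k. feasibility_cut k \<Longrightarrow> smin \<le> s k \<and> s k \<le> B"
proof (cases strat)
  case (Bounded_Centering smin)
  show thesis
  proof (rule that[of smin])
    show "smin > 0" using strategy Bounded_Centering by simp
    show "smin \<le> s k \<and> s k \<le> B" if "feasibility_cut k" for k
      using that unfolding feasibility_cut_def by (simp add: Bounded_Centering)
  qed
next
  case (Subgradient_Centering \<alpha>)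
  with strategy have \<alpha>: "0 < \<alpha>" "\<alpha> \<le> 1" by auto
  obtain xbar \<eta> where xbar: "xbar \<in> X" "\<eta> > 0" "\<And>t'. t' \<in> T \<Longrightarrow> g xbar t' \<le> - \<eta>"
    using slater_point by metis
  obtain R where R: "R > 0" "\<And>z. z \<in> X \<Longrightarrow> norm z \<le> R"
    using X_bounded bounded_pos by metis
  show thesis
  proof (rule that[of "\<alpha> * (\<eta> / (2 * R))"])
    show "\<alpha> * (\<eta> / (2 * R)) > 0" using \<alpha> xbar R by simp
    fix k assume k: "feasibility_cut k"
    then obtain d where d: "d \<in> subdiff_on \<Omega> (\<lambda>z. g z (t k)) (x k)" "s k = \<alpha> * norm d"
      unfolding feasibility_cut_def by (auto simp: Subgradient_Centering)
    have dB: "norm d \<le> B"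
      using subgradient_bounded[OF _ _ d(1)] k by (simp add: feasibility_cut_def)
    have "g (x k) (t k) + d \<bullet> (xbar - x k) \<le> g xbar (t k)"
      using subgradient_inequality[OF d(1) xbar(1)] .
    with k xbar(3)[of "t k"] have "\<eta> \<le> - (d \<bullet> (xbar - x k))"
      by (auto simp: feasibility_cut_def)
    also have "\<dots> \<le> norm d * norm (xbar - x k)"
      using Cauchy_Schwarz_ineq2[of d "xbar - x k"] by simp
    also have "\<dots> \<le> norm d * (2 * R)"
      using R(2)[OF xbar(1)] R(2)[of "x k"] k norm_triangle_ineq4[of xbar "x k"]
      by (intro mult_left_mono) (auto simp: feasibility_cut_def)
    finally have "\<eta> / (2 * R) \<le> norm d"
      using R(1) by (simp add: divide_le_eq)
    moreover have "\<alpha> * norm d \<le> 1 * B"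
      using \<alpha> dB by (intro mult_mono) auto
    ultimately show "\<alpha> * (\<eta> / (2 * R)) \<le> s k \<and> s k \<le> B"
      using \<alpha> d(2) mult_left_mono[of "\<eta> / (2 * R)" "norm d" \<alpha>] by simp
  qed
qed

lemma retained_cut:
  assumes "j \<in> J k"
  shows "t j \<in> T" "0 \<le> s j" "s j \<le> B"
proof -
  obtain smin where "smin > 0" "\<And>k. feasibility_cut k \<Longrightarrow> smin \<le> s k \<and> s k \<le> B"
    using centering_bounds by blast
  moreover have "feasibility_cut j" using J_feasibility_cut assms by blast
  ultimately show "t j \<in> T" "0 \<le> s j" "s j \<le> B"
    by (force simp: feasibility_cut_def)+
qed

section \<open>Progress of the master problem\<close>

text \<open>
The witness is a point \<open>z\<close> on the segment from \<open>x\<^sup>*\<close> to the Slater point. By convexity it satisfies every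
constraint with margin \<open>\<mu> \<eta>\<close>, and for small \<open>\<mu>\<close> its first coordinate exceeds \<open>x\<^sup>*\<^sub>0\<close> by at most
\<open>\<delta> / 2\<close>, so \<open>z\<close> together with a value \<open>c\<close> bounded by these two margins is feasible for the master problem.
The constant is the same for all iterations because \<open>s \<le> B\<close>.
\<close>

lemma sigma_bounded_below:
  assumes "\<delta> > 0"
  obtains c where "c > 0" "\<And>k. y k $ i0 \<ge> xstar $ i0 + \<delta> \<Longrightarrow> c \<le> \<sigma> (Suc k)"
proof -
  obtain xbar \<eta> where xbar: "xbar \<in> X" "\<eta> > 0" "\<And>t'. t' \<in> T \<Longrightarrow> g xbar t' \<le> - \<eta>"
    using slater_point by metis
  define M where "M = 1 + \<bar>xbar $ i0 - xstar $ i0\<bar>"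
  define \<mu> where "\<mu> = min 1 (\<delta> / (2 * M))"
  define c where "c = min (\<mu> * \<eta> / B) (\<delta> / 2)"
  define z where "z = (1 - \<mu>) *\<^sub>R xstar + \<mu> *\<^sub>R xbar"
  have "M > 0" by (simp add: M_def)
  then have \<mu>: "0 < \<mu>" "\<mu> \<le> 1" "\<mu> * M \<le> \<delta> / 2"
    using assms by (auto simp: \<mu>_def min_def field_simps)
  have c: "0 < c" "c * B \<le> \<mu> * \<eta>" "c \<le> \<delta> / 2"
    using \<mu> xbar(2) B_pos assms by (auto simp: c_def min_def field_simps)
  have z: "z \<in> X"
    unfolding z_def using X_convex xstar_feasible(1) xbar(1) \<mu>
    by (intro convexD) auto
  have "z $ i0 = xstar $ i0 + \<mu> * (xbar $ i0 - xstar $ i0)"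
    by (simp add: z_def algebra_simps)
  also have "\<dots> \<le> xstar $ i0 + \<mu> * M"
    using \<mu> by (intro add_left_mono mult_left_mono) (auto simp: M_def)
  finally have z0: "z $ i0 \<le> xstar $ i0 + \<delta> / 2"
    using \<mu>(3) by simp
  have gz: "g z t' \<le> - (\<mu> * \<eta>)" if "t' \<in> T" for t'
  proof -
    have "g z t' \<le> (1 - \<mu>) * g xstar t' + \<mu> * g xbar t'"
      unfolding z_def using \<mu> xstar_feasible(1) xbar(1)
      by (intro convex_onD[OF g_convex[OF that]]) auto
    also have "\<dots> \<le> (1 - \<mu>) * 0 + \<mu> * (- \<eta>)"
      using \<mu> xstar_feasible(2)[OF that] xbar(3)[OF that]
      by (intro add_mono mult_left_mono) auto
    finally show ?thesis by simp
  qed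
  show thesis
  proof (rule that[OF c(1)])
    fix k assume k: "y k $ i0 \<ge> xstar $ i0 + \<delta>"
    show "c \<le> \<sigma> (Suc k)"
    proof (rule master_maximal[OF z])
      show "z $ i0 + c \<le> y k $ i0" using z0 c(3) k by simp
      show "g z (t j) + c * s j \<le> 0" if "j \<in> J k" for j
        using gz[OF retained_cut(1)[OF that]] c retained_cut(3)[OF that]
          mult_left_mono[of "s j" B c] by linarith
    qed
  qed
qed

text \<open>
Here \<open>\<sigma>\<close> may be negative, so an optimality cut may increase \<open>y\<^sub>0\<close>. It cannot overshoot \<open>x\<^sup>*\<^sub>0\<close>: the pair of
\<open>x\<^sup>*\<close> and the nonpositive number \<open>y\<^sub>0 - x\<^sup>*\<^sub>0\<close> is feasible for the master problem, which bounds \<open>\<sigma>\<close> from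
below and hence \<open>x\<^sub>0 \<le> y\<^sub>0 - \<sigma>\<close> from above.
\<close>

lemma objective_below_optimum_stays:
  assumes "y k $ i0 \<le> xstar $ i0"
  shows "y (Suc k) $ i0 \<le> xstar $ i0"
proof (cases k rule: iteration_cases)
  case optimality
  have "y k $ i0 - xstar $ i0 \<le> \<sigma> (Suc k)"
  proof (rule master_maximal[OF xstar_feasible(1)])
    show "g xstar (t j) + (y k $ i0 - xstar $ i0) * s j \<le> 0" if "j \<in> J k" for j
      using xstar_feasible(2)[OF retained_cut(1)[OF that]] retained_cut(2)[OF that] assms
        mult_nonpos_nonneg[of "y k $ i0 - xstar $ i0" "s j"] by simp
  qed simp
  with master_solution(2)[of k] optimality(2) show ?thesis by simp
qed (use assms in simp)

lemma objective_nonincreasing: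
  assumes "\<sigma> (Suc k) > 0"
  shows "y (Suc k) $ i0 \<le> y k $ i0"
  using assms master_solution(2)[of k] by (cases k rule: iteration_cases) auto

text \<open>
The cuts dropped after solving a master problem are inactive at its solution. If the next master problem
had a larger value, a short step from the old solution towards the new one would respect the dropped
cuts by their slack and all other constraints by convexity, and so improve on the old optimum. Positivity
of \<open>\<sigma>\<close> ensures that the bound \<open>y\<^sub>0\<close> in the next master problem is not the weaker one.
\<close>

lemma sigma_nonincreasing:
  assumes "\<sigma> (Suc k) > 0"
  shows "\<sigma> (Suc (Suc k)) \<le> \<sigma> (Suc k)"
proof (rule ccontr)
  let ?x = "x (Suc k)" and ?x' = "x (Suc (Suc k))"
    and ?\<sigma> = "\<sigma> (Suc k)" and ?\<sigma>' = "\<sigma> (Suc (Suc k))"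
  assume "\<not> ?\<sigma>' \<le> ?\<sigma>"
  then have less: "?\<sigma> < ?\<sigma>'" by simp
  have inactive: "g ?x (t j) + ?\<sigma> * s j < 0" if "j \<in> J k - J (Suc k)" for j
    using that by (cases k rule: iteration_cases) (auto simp: dropped_cuts_def)
  obtain \<mu> where \<mu>: "0 < \<mu>" "\<mu> \<le> 1"
    and slack: "\<And>j. j \<in> J k - J (Suc k) \<Longrightarrow>
      (1 - \<mu>) * (g ?x (t j) + ?\<sigma> * s j) + \<mu> * (g ?x' (t j) + ?\<sigma>' * s j) \<le> 0"
    using inactive_cut_slack[of "J k - J (Suc k)" "\<lambda>j. g ?x (t j) + ?\<sigma> * s j"
        "\<lambda>j. g ?x' (t j) + ?\<sigma>' * s j"] inactive J_feasibility_cut by (metis finite_Diff)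
  define z where "z = (1 - \<mu>) *\<^sub>R ?x + \<mu> *\<^sub>R ?x'"
  define \<tau> where "\<tau> = (1 - \<mu>) * ?\<sigma> + \<mu> * ?\<sigma>'"
  have "\<tau> \<le> ?\<sigma>"
  proof (rule master_maximal)
    show "z \<in> X"
      unfolding z_def using X_convex master_solution(1) \<mu> by (intro convexD) auto
    have "z $ i0 + \<tau> = (1 - \<mu>) * (?x $ i0 + ?\<sigma>) + \<mu> * (?x' $ i0 + ?\<sigma>')"
      by (simp add: z_def \<tau>_def algebra_simps)
    also have "\<dots> \<le> (1 - \<mu>) * y k $ i0 + \<mu> * y k $ i0"
      using \<mu> master_solution(2)[of k] master_solution(2)[of "Suc k"]
        objective_nonincreasing[OF assms]
      by (intro add_mono mult_left_mono) auto
    finally show "z $ i0 + \<tau> \<le> y k $ i0" by (simp add: algebra_simps)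
    fix j assume j: "j \<in> J k"
    have "g z (t j) \<le> (1 - \<mu>) * g ?x (t j) + \<mu> * g ?x' (t j)"
      unfolding z_def using \<mu> master_solution(1)
      by (intro convex_onD[OF g_convex[OF retained_cut(1)[OF j]]]) auto
    then have "g z (t j) + \<tau> * s j
        \<le> (1 - \<mu>) * (g ?x (t j) + ?\<sigma> * s j) + \<mu> * (g ?x' (t j) + ?\<sigma>' * s j)"
      by (simp add: \<tau>_def algebra_simps)
    also have "\<dots> \<le> 0"
    proof (cases "j \<in> J (Suc k)")
      case True
      have "(1 - \<mu>) * (g ?x (t j) + ?\<sigma> * s j) + \<mu> * (g ?x' (t j) + ?\<sigma>' * s j)
          \<le> (1 - \<mu>) * 0 + \<mu> * 0"
        using \<mu> master_solution(3)[OF j] master_solution(3)[OF True]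
        by (intro add_mono mult_left_mono) auto
      then show ?thesis by simp
    qed (use slack j in auto)
    finally show "g z (t j) + \<tau> * s j \<le> 0" .
  qed
  moreover have "\<tau> = ?\<sigma> + \<mu> * (?\<sigma>' - ?\<sigma>)" by (simp add: \<tau>_def algebra_simps)
  ultimately show False using \<mu>(1) less by (simp add: mult_le_0_iff)
qed

text \<open>
The cut \<open>j\<close> was generated where \<open>g\<close> is positive, and as long as it is retained it forces
\<open>g \<le> - \<sigma> s\<close> at the new iterate. The Lipschitz bound turns this gap into a distance.
\<close>

lemma cut_separation:
  assumes "j \<in> J k" "smin \<le> s j" "0 < c" "c \<le> \<sigma> (Suc k)" "0 < smin"
  shows "c * smin / B \<le> dist (x (Suc k)) (x j)"
proof -
  have j: "feasibility_cut j" using J_feasibility_cut assms(1) by blast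
  have "c * smin \<le> \<sigma> (Suc k) * s j"
    using assms by (intro mult_mono) auto
  also have "\<dots> \<le> g (x j) (t j) - g (x (Suc k)) (t j)"
    using master_solution(3)[OF assms(1)] j by (simp add: feasibility_cut_def)
  also have "\<dots> \<le> dist (g (x (Suc k)) (t j)) (g (x j) (t j))"
    by (simp add: dist_real_def)
  also have "\<dots> \<le> B * dist (x (Suc k)) (x j)"
    using lipschitz_onD[OF g_lipschitz] j master_solution(1) by (simp add: feasibility_cut_def)
  finally show ?thesis using B_pos by (simp add: divide_le_eq mult.commute)
qed

section \<open>Convergence\<close>

text \<open>
Under the hypotheses, from some iteration \<open>K\<close> on every iteration adds a feasibility cut and none of these
cuts is ever dropped, so the iterates after \<open>K\<close> are pairwise separated by a fixed distance.
\<close>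

lemma sigma_not_bounded_away:
  assumes "c > 0" and sigma: "\<And>k. c \<le> \<sigma> (Suc k)" and bdd: "\<And>k. m \<le> y k $ i0"
  shows False
proof -
  have sigma_pos: "\<sigma> (Suc k) > 0" for k
    using \<open>c > 0\<close> sigma[of k] by simp
  have "decseq (\<lambda>k. y k $ i0)"
    by (intro decseq_SucI objective_nonincreasing sigma_pos)
  \<comment> \<open>An optimality cut lowers the value by at least \<open>c\<close>, so it is excluded once the convergent value
    sequence is within \<open>c\<close> of its limit.\<close>
  with bdd obtain l where "(\<lambda>k. y k $ i0) \<longlonglongrightarrow> l" "\<And>k. l \<le> y k $ i0"
    using decseq_convergent by metis
  moreover from this(1) have "eventually (\<lambda>k. y k $ i0 < l + c) sequentially"
    using order_tendstoD(2)[of _ l sequentially "l + c"] \<open>c > 0\<close> by simp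
  ultimately obtain K1 where K1: "\<And>k. k \<ge> K1 \<Longrightarrow> y k $ i0 < y (Suc k) $ i0 + c"
    unfolding eventually_sequentially by (meson add_right_mono less_le_trans)
  \<comment> \<open>The dropping criterion compares values of \<open>\<sigma>\<close> whose ratio is eventually below \<open>\<beta>\<close>.\<close>
  have "decseq (\<lambda>k. \<sigma> (Suc k))"
    by (intro decseq_SucI sigma_nonincreasing sigma_pos)
  have "\<exists>K. \<forall>j\<ge>K. \<forall>k\<ge>K. \<beta> \<noteq> \<infinity> \<longrightarrow> \<sigma> (Suc j) < real_of_ereal \<beta> * \<sigma> (Suc k)"
  proof (cases \<beta>)
    case (real b)
    with \<beta>_gt have "b > 1" by simp
    from eventually_ratio_less_of_decseq[OF \<open>decseq (\<lambda>k. \<sigma> (Suc k))\<close> \<open>c > 0\<close> sigma this]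
    show ?thesis by (simp add: real)
  qed (use \<beta>_gt in auto)
  then obtain K2 where K2: "\<And>j k. j \<ge> K2 \<Longrightarrow> k \<ge> K2 \<Longrightarrow> \<beta> \<noteq> \<infinity> \<Longrightarrow>
      \<sigma> (Suc j) < real_of_ereal \<beta> * \<sigma> (Suc k)"
    by blast
  define K where "K = max K1 K2"
  have grows: "Suc i \<in> J (Suc k)" if "K \<le> i" "K \<le> k" "Suc i \<in> insert (Suc k) (J k)" for i k
  proof (cases k rule: iteration_cases)
    case feasibility
    have "\<sigma> (Suc i) < real_of_ereal \<beta> * \<sigma> (Suc k)" if "\<beta> \<noteq> \<infinity>"
      using K2[of i k] \<open>K \<le> i\<close> \<open>K \<le> k\<close> that by (simp add: K_def)
    then have "Suc i \<notin> dropped_cuts \<beta> g x \<sigma> t s (Suc k) (insert (Suc k) (J k))"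
      unfolding dropped_cuts_def by (metis (mono_tags, lifting) mem_Collect_eq not_less)
    with feasibility(3) that(3) show ?thesis by simp
  next
    case optimality
    have "y (Suc k) $ i0 + c \<le> y k $ i0"
      using master_solution(2)[of k] sigma[of k] optimality(2) by simp
    moreover have "y k $ i0 < y (Suc k) $ i0 + c"
      using K1[of k] \<open>K \<le> k\<close> by (simp add: K_def)
    ultimately show ?thesis by linarith
  qed
  have kept: "Suc j \<in> J k" if "K \<le> j" "Suc j \<le> k" for j k
    using that(2)
  proof (induction k rule: dec_induct)
    case base
    show ?case using grows[of j j] that(1) by simp
  next
    case (step k)
    then show ?case using grows[of j k] that(1) by simp
  qed
  obtain smin where smin: "smin > 0" "\<And>k. feasibility_cut k \<Longrightarrow> smin \<le> s k \<and> s k \<le> B"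
    using centering_bounds by metis
  have "bounded (range (\<lambda>k. x (Suc (K + k))))"
    by (rule bounded_subset[OF X_bounded]) (use master_solution(1) in auto)
  from bounded_sequence_not_separated[OF this, of "c * smin / B"]
  obtain j k where jk: "j < k" "dist (x (Suc (K + k))) (x (Suc (K + j))) < c * smin / B"
    using \<open>c > 0\<close> smin(1) B_pos by auto
  have "Suc (K + j) \<in> J (K + k)" using kept jk(1) by simp
  moreover from this have "smin \<le> s (Suc (K + j))"
    using smin(2) J_feasibility_cut by blast
  ultimately show False
    using cut_separation[of "Suc (K + j)" "K + k" smin c] sigma jk(2) smin(1) \<open>c > 0\<close> by simp
qed

text \<open>
The bound, once reached, persists: above \<open>x\<^sup>*\<^sub>0\<close> the value \<open>\<sigma>\<close> is positive and \<open>y\<^sub>0\<close> does not increase, and below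
\<open>x\<^sup>*\<^sub>0\<close> it stays there. If it were never reached, \<open>\<sigma>\<close> would be bounded away from zero.
\<close>

lemma objective_eventually_near_optimum:
  assumes "\<delta> > 0"
  shows "eventually (\<lambda>k. y k $ i0 \<le> xstar $ i0 + \<delta>) sequentially"
proof -
  have stays: "y (Suc k) $ i0 \<le> xstar $ i0 + \<delta>" if "y k $ i0 \<le> xstar $ i0 + \<delta>" for k
  proof (cases "y k $ i0 \<le> xstar $ i0")
    case True
    with objective_below_optimum_stays[of k] assms show ?thesis by simp
  next
    case False
    then have "y k $ i0 - xstar $ i0 > 0" by simp
    then obtain c where "c > 0"
      "\<And>k'. y k' $ i0 \<ge> xstar $ i0 + (y k $ i0 - xstar $ i0) \<Longrightarrow> c \<le> \<sigma> (Suc k')"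
      using sigma_bounded_below by blast
    from this(1) this(2)[of k] objective_nonincreasing[of k] that show ?thesis by simp
  qed
  have "\<exists>K. y K $ i0 \<le> xstar $ i0 + \<delta>"
  proof (rule ccontr)
    assume "\<nexists>K. y K $ i0 \<le> xstar $ i0 + \<delta>"
    then have far: "\<And>k. xstar $ i0 + \<delta> \<le> y k $ i0" by (meson linear)
    obtain c where "c > 0" "\<And>k. y k $ i0 \<ge> xstar $ i0 + \<delta> \<Longrightarrow> c \<le> \<sigma> (Suc k)"
      using sigma_bounded_below[OF assms] by metis
    with sigma_not_bounded_away[of c] far show False by blast
  qed
  then obtain K where K: "y K $ i0 \<le> xstar $ i0 + \<delta>" ..
  have "y k $ i0 \<le> xstar $ i0 + \<delta>" if "k \<ge> K" for k
    using that by (induction k rule: dec_induct) (use K stays in auto)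
  then show ?thesis unfolding eventually_sequentially by blast
qed

text \<open>
The only value of \<open>y\<close> that need not be \<open>\<epsilon>\<close>-feasible is the initial one, and its first coordinate \<open>U\<close> is
strictly larger than \<open>x\<^sup>*\<^sub>0\<close>.
\<close>

lemma eventually_eps_feasible: "eventually (\<lambda>k. eps_feasible X T g \<epsilon> (y k)) sequentially"
proof -
  have feasible_or_initial: "eps_feasible X T g \<epsilon> (y k) \<or> y k = y 0" for k
  proof (induction k)
    case (Suc k)
    then show ?case by (cases k rule: iteration_cases) auto
  qed simp
  have "eventually (\<lambda>k. y k $ i0 \<le> xstar $ i0 + (U - xstar $ i0) / 2) sequentially"
    using objective_eventually_near_optimum U_gt by simp
  then have "eventually (\<lambda>k. y k \<noteq> y 0) sequentially"
    by eventually_elim (use initial(1) U_gt in \<open>auto simp: field_simps\<close>)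
  then show ?thesis
    by (rule eventually_mono) (use feasible_or_initial in blast)
qed

lemma accumulation_point_exists: "\<exists>z. accumulation_point (\<lambda>k. y (Suc k)) z"
proof -
  obtain K where K: "\<And>k. k \<ge> K \<Longrightarrow> eps_feasible X T g \<epsilon> (y k)"
    using eventually_eps_feasible unfolding eventually_sequentially by blast
  have "bounded (range (\<lambda>k. y (Suc (k + K))))"
    by (rule bounded_subset[OF X_bounded]) (use K in \<open>auto simp: eps_feasible_def\<close>)
  then obtain z r where r: "strict_mono (r :: nat \<Rightarrow> nat)" "((\<lambda>k. y (Suc (k + K))) \<circ> r) \<longlonglongrightarrow> z"
    using bounded_imp_convergent_subsequence by blast
  then have "strict_mono (\<lambda>k. r k + K)" "((\<lambda>k. y (Suc k)) \<circ> (\<lambda>k. r k + K)) \<longlonglongrightarrow> z"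
    by (auto simp: strict_mono_def comp_def)
  then show ?thesis unfolding accumulation_point_def by blast
qed

lemma accumulation_point_eps_optimal:
  assumes "accumulation_point (\<lambda>k. y (Suc k)) z"
  shows "eps_optimal i0 X T g \<epsilon> xstar z"
proof -
  obtain r where r: "strict_mono r" "(\<lambda>k. y (Suc (r k))) \<longlonglongrightarrow> z"
    using assms by (auto simp: accumulation_point_def comp_def)
  have sub: "filterlim (\<lambda>k. Suc (r k)) sequentially sequentially"
    using filterlim_compose[OF filterlim_Suc filterlim_subseq[OF r(1)]] .
  have "z \<in> {z. eps_feasible X T g \<epsilon> z}"
    using Lim_in_closed_set[OF closed_eps_feasible _ _ r(2)]
      eventually_compose_filterlim[OF eventually_eps_feasible sub] by simp
  moreover have "z $ i0 \<le> xstar $ i0 + \<delta>" if "\<delta> > 0" for \<delta>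
    using tendsto_upperbound[OF tendsto_vec_nth[OF r(2)]
        eventually_compose_filterlim[OF objective_eventually_near_optimum[OF that] sub]] by simp
  ultimately show ?thesis
    by (auto simp: eps_optimal_def intro: field_le_epsilon)
qed

end

theorem theorem4:
  fixes i0 :: "'n::finite"
    and X \<Omega> :: "(real^'n) set"
    and T :: "'t set"
    and g :: "real^'n \<Rightarrow> 't \<Rightarrow> real"
    and U B \<epsilon> :: real
    and \<beta> :: ereal
    and search :: "real^'n \<Rightarrow> 't option set"
    and strat :: centering_strategy
    and xstar :: "real^'n"
    and x y :: "nat \<Rightarrow> real^'n"
    and \<sigma> s :: "nat \<Rightarrow> real"
    and t :: "nat \<Rightarrow> 't"
    and J :: "nat \<Rightarrow> nat set"
  assumes "sicp_assumption1 \<Omega> X T g B"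
    and "\<epsilon> \<ge> 0"
    and "sicp_assumption2 X T g \<epsilon> search"
    and "sicp_optimal i0 X T g xstar"
    and "xstar $ i0 < U"
    and "\<beta> > 1"
    and "valid_strategy strat"
    and "cutting_surface_execution i0 \<Omega> X g U B \<beta> search strat x \<sigma> t s y J"
    and "\<not> execution_terminates \<sigma>"
  shows "(\<exists>z. accumulation_point (\<lambda>k. y (Suc k)) z) \<and>
         (\<forall>z. accumulation_point (\<lambda>k. y (Suc k)) z \<longrightarrow> eps_optimal i0 X T g \<epsilon> xstar z)"
proof -
  interpret nonterminating_execution i0 X \<Omega> T g U B \<epsilon> \<beta> search strat xstar x y \<sigma> s t J
    using assms by unfold_locales
  show ?thesis
    using accumulation_point_exists accumulation_point_eps_optimal by blast
qed

end
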